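(* Let $(\mathcal{A},\leq,\otimes,\neg)$ be a conjunctive structure. For all typing contexts $\Gamma,\Delta$, all formulas with parameters $A$ and all substitutions $\sigma$ such that $\sigma\Vdash\Gamma$ and $\sigma\Vdash\Delta$: (1) for any term $t$, if $\Gamma\vdash t:A\mid\Delta$ then $(t[\sigma])^\mathcal{A}\leq A[\sigma]^\mathcal{A}$; (2) for any context $e$, if $\Gamma\mid e:A\vdash\Delta$ then $(e[\sigma])^\mathcal{A}\geq A[\sigma]^\mathcal{A}$; (3) for any command $c$, if $c:(\Gamma\vdash\Delta)$ then $(c[\sigma])^\mathcal{A}$ belongs to the pole, i.e. for $c=\langle t\| e\rangle$, $(t[\sigma])^\mathcal{A}\leq(e[\sigma])^\mathcal{A}$.
   Context: A conjunctive structure is a quadruple $(\mathcal{A},\leq,\otimes,\neg)$ where $(\mathcal{A},\leq)$ is a complete lattice (meets $\bigwedge$, joins $\bigvee$), $\otimes$ is binary and monotone in both arguments, $\neg$ is unary and antitone, $\bigvee_{b\in B}(a\otimes b)=a\otimes\bigvee_{b\in B}b$ and $\bigvee_{b\in B}(b\otimes a)=(\bigvee_{b\in B}b)\otimes a$, and $\neg(\bigvee_{b\in B}b)=\bigwedge_{b\in B}\neg b$. The calculus $\mathrm{L}^{\otimes}$ has terms $t::=x\mid(t,t)\mid[e]\mid\mu\alpha.c$, values $V::=x\mid(V,V)\mid[e]$, contexts $e::=\alpha\mid\mu(x,y).c\mid\mu[\alpha].c\mid\mu x.c$, commands $c::=\langle t\| e\rangle$, and formulas with parameters $A,B::=a\mid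 X\mid A\otimes B\mid\neg A\mid\exists X.A$ ($a\in\mathcal{A}$). Typing rules: (Cut) from $\Gamma\vdash t:A\mid\Delta$ and $\Gamma\mid e:A\vdash\Delta$ infer $\langle t\| e\rangle:(\Gamma\vdash\Delta)$; axioms $\Gamma\mid\alpha:A\vdash\Delta$ if $(\alpha:A)\in\Delta$ and $\Gamma\vdash x:A\mid\Delta$ if $(x:A)\in\Gamma$; from $c:(\Gamma,x:A\vdash\Delta)$ infer $\Gamma\mid\mu x.c:A\vdash\Delta$; from $c:(\Gamma,x:A,x':B\vdash\Delta)$ infer $\Gamma\mid\mu(x,x').c:A\otimes B\vdash\Delta$; from $c:(\Gamma\vdash\Delta,\alpha:A)$ infer $\Gamma\mid\mu[\alpha].c:\neg A\vdash\Delta$; from $c:(\Gamma\vdash\Delta,\alpha:A)$ infer $\Gamma\vdash\mu\alpha.c:A\mid\Delta$; from $\Gamma\vdash t:A\mid\Delta$ and $\Gamma\vdash u:B\mid\Delta$ infer $\Gamma\vdash(t,u):A\otimes B\mid\Delta$; from $\Gamma\mid e:A\vdash\Delta$ infer $\Gamma\vdash[e]:\neg A\mid\Delta$; from $\Gamma\mid e:A\vdash\Delta$ with $X$ not free in $\Gamma,\Delta$ infer $\Gamma\mid e:\exists X.A\vdash\Delta$; from $\Gamma\vdash V:A[B/X]\mid\Delta$ infer $\Gamma\vdash V:\exists X.A\mid\Delta$. A command $(a,b)$ is in the pole iff $a\leq b$. Interpretation: $a^\mathcal{A}=a$; $(t,u)^\mathcal{A}=t^\mathcal{A}\otimes u^\mathcal{A}$;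 $[e]^\mathcal{A}=\neg e^\mathcal{A}$; $(\mu\alpha.c)^\mathcal{A}=\bigwedge\{a:(c[\alpha:=a])^\mathcal{A}\text{ in the pole}\}$; $(\mu x.c)^\mathcal{A}=\bigvee\{a:(c[x:=a])^\mathcal{A}\text{ in the pole}\}$; $(\mu(x,y).c)^\mathcal{A}=\bigvee\{a\otimes b:(c[x:=a,y:=b])^\mathcal{A}\text{ in the pole}\}$; $(\mu[\alpha].c)^\mathcal{A}=\bigvee\{\neg a:(c[\alpha:=a])^\mathcal{A}\text{ in the pole}\}$; $\langle t\| e\rangle^\mathcal{A}=(t^\mathcal{A},e^\mathcal{A})$. Formulas: $a^\mathcal{A}=a$, $(\neg A)^\mathcal{A}=\neg A^\mathcal{A}$, $(A\otimes B)^\mathcal{A}=A^\mathcal{A}\otimes B^\mathcal{A}$, $(\exists X.A)^\mathcal{A}=\bigvee_{a\in\mathcal{A}}(A\{X:=a\})^\mathcal{A}$. Substitutions $\sigma$ map variables to elements of $\mathcal{A}$; $\sigma\Vdash\Gamma$ if $\sigma(x)\leq(A[\sigma])^\mathcal{A}$ for $(x:A)\in\Gamma$, and $\sigma\Vdash\Delta$ if $\sigma(\alpha)\geq(A[\sigma])^\mathcal{A}$ for $(\alpha:A)\in\Delta$. *)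

theory Defs
  imports "HOL-Library.Finite_Map"
begin

class conjunctive_structure = complete_lattice +
  fixes tensor :: "'a \<Rightarrow> 'a \<Rightarrow> 'a"  (infixr "\<otimes>" 75)
    and neg :: "'a \<Rightarrow> 'a"
  assumes tensor_mono: "a \<le> a' \<Longrightarrow> b \<le> b' \<Longrightarrow> a \<otimes> b \<le> a' \<otimes> b'"
    and neg_antimono: "a \<le> b \<Longrightarrow> neg b \<le> neg a"
    and tensor_Sup_right: "(SUP b\<in>B. a \<otimes> b) = a \<otimes> Sup B"
    and tensor_Sup_left: "(SUP b\<in>B. b \<otimes> a) = Sup B \<otimes> a"
    and neg_Sup: "neg (Sup B) = (INF b\<in>B. neg b)"

definition pole :: "('a::conjunctive_structure \<times> 'a) set" where
  "pole = {(a, b). a \<le> b}"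

text \<open>
  Formulas are taken up to renaming of bound variables: the core syntax uses de Bruijn indices,
  and an index that points beyond all enclosing quantifiers is read as the name of a free formula
  variable. The named quantifier is the function \<open>Exists\<close> below; every formula \<open>FEx A\<close> is of this
  form (lemma \<open>FEx_eq_Exists\<close>).
\<close>

datatype 'a fm =
    FPar 'a
  | FVar nat
  | FTensor "'a fm" "'a fm"
  | FNeg "'a fm"
  | FEx "'a fm"

primrec fm_rename :: "(nat \<Rightarrow> nat) \<Rightarrow> 'a fm \<Rightarrow> 'a fm" where
  "fm_rename f (FPar a) = FPar a"
| "fm_rename f (FVar X) = FVar (f X)"
| "fm_rename f (FTensor A B) = FTensor (fm_rename f A) (fm_rename f B)"
| "fm_rename f (FNeg A) = FNeg (fm_rename f A)"
| "fm_rename f (FEx A) = FEx (fm_rename (case_nat 0 (\<lambda>X. Suc (f X))) A)"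

primrec fm_subst :: "(nat \<Rightarrow> 'a fm) \<Rightarrow> 'a fm \<Rightarrow> 'a fm" where
  "fm_subst \<theta> (FPar a) = FPar a"
| "fm_subst \<theta> (FVar X) = \<theta> X"
| "fm_subst \<theta> (FTensor A B) = FTensor (fm_subst \<theta> A) (fm_subst \<theta> B)"
| "fm_subst \<theta> (FNeg A) = FNeg (fm_subst \<theta> A)"
| "fm_subst \<theta> (FEx A) = FEx (fm_subst (case_nat (FVar 0) (\<lambda>X. fm_rename Suc (\<theta> X))) A)"

primrec fm_fv :: "'a fm \<Rightarrow> nat set" where
  "fm_fv (FPar a) = {}"
| "fm_fv (FVar X) = {X}"
| "fm_fv (FTensor A B) = fm_fv A \<union> fm_fv B"
| "fm_fv (FNeg A) = fm_fv A"
| "fm_fv (FEx A) = {X. Suc X \<in> fm_fv A}"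

definition Exists :: "nat \<Rightarrow> 'a fm \<Rightarrow> 'a fm" where
  "Exists X A = FEx (fm_rename (\<lambda>Y. if Y = X then 0 else Suc Y) A)"

definition fm_inst :: "nat \<Rightarrow> 'a fm \<Rightarrow> 'a fm \<Rightarrow> 'a fm" where  \<comment> \<open>\<open>A[B/X]\<close>\<close>
  "fm_inst X B A = fm_subst (FVar(X := B)) A"

primrec fm_size :: "'a fm \<Rightarrow> nat" where
  "fm_size (FPar a) = 1"
| "fm_size (FVar X) = 1"
| "fm_size (FTensor A B) = Suc (fm_size A + fm_size B)"
| "fm_size (FNeg A) = Suc (fm_size A)"
| "fm_size (FEx A) = Suc (fm_size A)"

lemma fm_size_rename [simp]: "fm_size (fm_rename f A) = fm_size A"
  by (induction A arbitrary: f) auto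

lemma fm_size_subst: "(\<And>X. fm_size (\<theta> X) = 1) \<Longrightarrow> fm_size (fm_subst \<theta> A) = fm_size A"
proof (induction A arbitrary: \<theta>)
  case (FEx A)
  have "fm_size (case_nat (FVar 0) (\<lambda>X. fm_rename Suc (\<theta> X)) X) = 1" for X
    using FEx.prems by (cases X) auto
  then show ?case using FEx.IH by simp
qed auto

text \<open>
  The interpretation is meant for closed formulas; its value at a free variable is arbitrary.
\<close>

function fm_int :: "'a::conjunctive_structure fm \<Rightarrow> 'a" where
  "fm_int (FPar a) = a"
| "fm_int (FVar X) = undefined"
| "fm_int (FTensor A B) = fm_int A \<otimes> fm_int B"
| "fm_int (FNeg A) = neg (fm_int A)"
| "fm_int (FEx A) = (SUP a. fm_int (fm_subst (case_nat (FPar a) FVar) A))"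
  by pat_completeness auto
termination
proof (relation "measure fm_size", goal_cases)
  case (5 A a)
  have "fm_size (case_nat (FPar a) FVar X) = 1" for X
    by (cases X) auto
  then show ?case by (simp add: fm_size_subst)
qed auto

lemma fm_subst_rename: "fm_subst \<theta> (fm_rename f A) = fm_subst (\<lambda>X. \<theta> (f X)) A"
proof (induction A arbitrary: \<theta> f)
  case (FEx A)
  have "(\<lambda>X. case_nat (FVar 0) (\<lambda>X. fm_rename Suc (\<theta> X)) (case_nat 0 (\<lambda>X. Suc (f X)) X))
      = case_nat (FVar 0) (\<lambda>X. fm_rename Suc (\<theta> (f X)))"
    by (rule ext) (simp split: nat.split)
  then show ?case using FEx by simp
qed auto

lemma fm_int_Exists: "fm_int (Exists X A) = (SUP a. fm_int (fm_inst X (FPar a) A))"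
proof -
  have "(\<lambda>Y. case_nat (FPar a) FVar (if Y = X then 0 else Suc Y)) = FVar(X := FPar a)" for a :: 'a
    by (rule ext) simp
  then show ?thesis by (simp add: Exists_def fm_inst_def fm_subst_rename)
qed

lemma fm_rename_rename: "fm_rename f (fm_rename g A) = fm_rename (\<lambda>X. f (g X)) A"
proof (induction A arbitrary: f g)
  case (FEx A)
  have "(\<lambda>X. case_nat 0 (\<lambda>X. Suc (f X)) (case_nat 0 (\<lambda>X. Suc (g X)) X))
      = case_nat 0 (\<lambda>X. Suc (f (g X)))"
    by (rule ext) (simp split: nat.split)
  then show ?case using FEx by simp
qed auto

lemma fm_rename_id: "(\<And>X. X \<in> fm_fv A \<Longrightarrow> f X = X) \<Longrightarrow> fm_rename f A = A"
proof (induction A arbitrary: f)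
  case (FEx A)
  have "case_nat 0 (\<lambda>X. Suc (f X)) X = X" if "X \<in> fm_fv A" for X
    using FEx.prems that by (cases X) auto
  then show ?case using FEx.IH by simp
qed auto

lemma FEx_eq_Exists:
  assumes "X \<notin> fm_fv (FEx A)"
  shows "FEx A = Exists X (fm_rename (case_nat X id) A)"
proof -
  have "fm_rename (\<lambda>Y. if case_nat X id Y = X then 0 else Suc (case_nat X id Y)) A = A"
    by (rule fm_rename_id) (use assms in \<open>auto split: nat.splits\<close>)
  then show ?thesis by (simp add: Exists_def fm_rename_rename)
qed

text \<open>
  The parameters \<open>TPar\<close> and \<open>CPar\<close> do not belong to the calculus: they only serve to form
  the results of substitutions, and no typing rule applies to them. Bound variables are named.
  Only elements of the structure are ever substituted for variables, hence no capture can occur.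
\<close>

datatype 'a tm =
    TVar nat
  | TPar 'a
  | TPair "'a tm" "'a tm"
  | TBox "'a ctx"                  \<comment> \<open>\<open>[e]\<close>\<close>
  | TMu nat "'a cmd"               \<comment> \<open>\<open>\<mu>\<alpha>.c\<close>\<close>
and 'a ctx =
    CVar nat
  | CPar 'a
  | CMuPair nat nat "'a cmd"       \<comment> \<open>\<open>\<mu>(x,y).c\<close>\<close>
  | CMuBox nat "'a cmd"            \<comment> \<open>\<open>\<mu>[\<alpha>].c\<close>\<close>
  | CMu nat "'a cmd"               \<comment> \<open>\<open>\<mu>x.c\<close>\<close>
and 'a cmd =
    Cut "'a tm" "'a ctx"

primrec is_value :: "'a tm \<Rightarrow> bool" where
  "is_value (TVar x) \<longleftrightarrow> True"
| "is_value (TPar a) \<longleftrightarrow> False"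
| "is_value (TPair t u) \<longleftrightarrow> is_value t \<and> is_value u"
| "is_value (TBox e) \<longleftrightarrow> True"
| "is_value (TMu \<alpha> c) \<longleftrightarrow> False"

datatype var = TmVar nat | CtxVar nat | FmVar nat

primrec tm_subst :: "(var \<rightharpoonup> 'a) \<Rightarrow> 'a tm \<Rightarrow> 'a tm"
  and ctx_subst :: "(var \<rightharpoonup> 'a) \<Rightarrow> 'a ctx \<Rightarrow> 'a ctx"
  and cmd_subst :: "(var \<rightharpoonup> 'a) \<Rightarrow> 'a cmd \<Rightarrow> 'a cmd"
where
  "tm_subst s (TVar x) = (case s (TmVar x) of None \<Rightarrow> TVar x | Some a \<Rightarrow> TPar a)"
| "tm_subst s (TPar a) = TPar a"
| "tm_subst s (TPair t u) = TPair (tm_subst s t) (tm_subst s u)"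
| "tm_subst s (TBox e) = TBox (ctx_subst s e)"
| "tm_subst s (TMu \<alpha> c) = TMu \<alpha> (cmd_subst (s(CtxVar \<alpha> := None)) c)"
| "ctx_subst s (CVar \<alpha>) = (case s (CtxVar \<alpha>) of None \<Rightarrow> CVar \<alpha> | Some a \<Rightarrow> CPar a)"
| "ctx_subst s (CPar a) = CPar a"
| "ctx_subst s (CMuPair x y c) = CMuPair x y (cmd_subst (s(TmVar x := None, TmVar y := None)) c)"
| "ctx_subst s (CMuBox \<alpha> c) = CMuBox \<alpha> (cmd_subst (s(CtxVar \<alpha> := None)) c)"
| "ctx_subst s (CMu x c) = CMu x (cmd_subst (s(TmVar x := None)) c)"
| "cmd_subst s (Cut t e) = Cut (tm_subst s t) (ctx_subst s e)"

primrec tm_size :: "'a tm \<Rightarrow> nat"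
  and ctx_size :: "'a ctx \<Rightarrow> nat"
  and cmd_size :: "'a cmd \<Rightarrow> nat"
where
  "tm_size (TVar x) = 1"
| "tm_size (TPar a) = 1"
| "tm_size (TPair t u) = Suc (tm_size t + tm_size u)"
| "tm_size (TBox e) = Suc (ctx_size e)"
| "tm_size (TMu \<alpha> c) = Suc (cmd_size c)"
| "ctx_size (CVar \<alpha>) = 1"
| "ctx_size (CPar a) = 1"
| "ctx_size (CMuPair x y c) = Suc (cmd_size c)"
| "ctx_size (CMuBox \<alpha> c) = Suc (cmd_size c)"
| "ctx_size (CMu x c) = Suc (cmd_size c)"
| "cmd_size (Cut t e) = Suc (tm_size t + ctx_size e)"

lemma size_subst [simp]:
  fixes t :: "'a tm" and e :: "'a ctx" and c :: "'a cmd"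
  shows "tm_size (tm_subst s t) = tm_size t"
    and "ctx_size (ctx_subst s e) = ctx_size e"
    and "cmd_size (cmd_subst s c) = cmd_size c"
  by (induction t and e and c arbitrary: s and s and s) (auto split: option.split)

text \<open>
  As for formulas, the interpretation is meant for closed expressions; its value at a free
  variable is arbitrary.
\<close>

function tm_int :: "'a::conjunctive_structure tm \<Rightarrow> 'a"
  and ctx_int :: "'a::conjunctive_structure ctx \<Rightarrow> 'a"
  and cmd_int :: "'a::conjunctive_structure cmd \<Rightarrow> 'a \<times> 'a"
where
  "tm_int (TVar x) = undefined"
| "tm_int (TPar a) = a"
| "tm_int (TPair t u) = tm_int t \<otimes> tm_int u"
| "tm_int (TBox e) = neg (ctx_int e)"
| "tm_int (TMu \<alpha> c) = Inf {a. cmd_int (cmd_subst [CtxVar \<alpha> \<mapsto> a] c) \<in> pole}"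
| "ctx_int (CVar \<alpha>) = undefined"
| "ctx_int (CPar a) = a"
| "ctx_int (CMuPair x y c) =
     Sup {a \<otimes> b |a b. cmd_int (cmd_subst [TmVar x \<mapsto> a, TmVar y \<mapsto> b] c) \<in> pole}"
| "ctx_int (CMuBox \<alpha> c) = Sup {neg a |a. cmd_int (cmd_subst [CtxVar \<alpha> \<mapsto> a] c) \<in> pole}"
| "ctx_int (CMu x c) = Sup {a. cmd_int (cmd_subst [TmVar x \<mapsto> a] c) \<in> pole}"
| "cmd_int (Cut t e) = (tm_int t, ctx_int e)"
  by pat_completeness auto
termination
  by (relation "measure (case_sum tm_size (case_sum ctx_size cmd_size))") auto

text \<open>
  A typing context is a finite map, and \<open>\<Gamma>, x : A\<close> is \<open>fmupd x A \<Gamma>\<close>: an inner binding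
  of a name hides an outer one, so that typing does not depend on the choice of bound names.
\<close>

type_synonym 'a tyctx = "(nat, 'a fm) fmap"

inductive tm_typed :: "'a tyctx \<Rightarrow> 'a tm \<Rightarrow> 'a fm \<Rightarrow> 'a tyctx \<Rightarrow> bool"
      ("_ \<turnstile> _ : _ / \<parallel> _" [51, 51, 51, 51] 50)
  and ctx_typed :: "'a tyctx \<Rightarrow> 'a ctx \<Rightarrow> 'a fm \<Rightarrow> 'a tyctx \<Rightarrow> bool"
      ("_ \<parallel> _ : _ / \<turnstile> _" [51, 51, 51, 51] 50)
  and cmd_typed :: "'a cmd \<Rightarrow> 'a tyctx \<Rightarrow> 'a tyctx \<Rightarrow> bool"
      ("_ : '(_ \<turnstile> _')" [51, 51, 51] 50)
where
  cut: "\<Gamma> \<turnstile> t : A \<parallel> \<Delta> \<Longrightarrow> \<Gamma> \<parallel> e : A \<turnstile> \<Delta> \<Longrightarrow> Cut t e : (\<Gamma> \<turnstile> \<Delta>)"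
| ax_left: "fmlookup \<Delta> \<alpha> = Some A \<Longrightarrow> \<Gamma> \<parallel> CVar \<alpha> : A \<turnstile> \<Delta>"
| ax_right: "fmlookup \<Gamma> x = Some A \<Longrightarrow> \<Gamma> \<turnstile> TVar x : A \<parallel> \<Delta>"
| mu_left: "c : (fmupd x A \<Gamma> \<turnstile> \<Delta>) \<Longrightarrow> \<Gamma> \<parallel> CMu x c : A \<turnstile> \<Delta>"
| tensor_left: "x \<noteq> x' \<Longrightarrow> c : (fmupd x' B (fmupd x A \<Gamma>) \<turnstile> \<Delta>) \<Longrightarrow>
    \<Gamma> \<parallel> CMuPair x x' c : FTensor A B \<turnstile> \<Delta>"
| neg_left: "c : (\<Gamma> \<turnstile> fmupd \<alpha> A \<Delta>) \<Longrightarrow> \<Gamma> \<parallel> CMuBox \<alpha> c : FNeg A \<turnstile> \<Delta>"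
| mu_right: "c : (\<Gamma> \<turnstile> fmupd \<alpha> A \<Delta>) \<Longrightarrow> \<Gamma> \<turnstile> TMu \<alpha> c : A \<parallel> \<Delta>"
| tensor_right: "\<Gamma> \<turnstile> t : A \<parallel> \<Delta> \<Longrightarrow> \<Gamma> \<turnstile> u : B \<parallel> \<Delta> \<Longrightarrow> \<Gamma> \<turnstile> TPair t u : FTensor A B \<parallel> \<Delta>"
| neg_right: "\<Gamma> \<parallel> e : A \<turnstile> \<Delta> \<Longrightarrow> \<Gamma> \<turnstile> TBox e : FNeg A \<parallel> \<Delta>"
| exists_left: "\<Gamma> \<parallel> e : A \<turnstile> \<Delta> \<Longrightarrow> \<forall>B \<in> fmran' \<Gamma> \<union> fmran' \<Delta>. X \<notin> fm_fv B \<Longrightarrow>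
    \<Gamma> \<parallel> e : Exists X A \<turnstile> \<Delta>"
| exists_right: "is_value V \<Longrightarrow> \<Gamma> \<turnstile> V : fm_inst X B A \<parallel> \<Delta> \<Longrightarrow> \<Gamma> \<turnstile> V : Exists X A \<parallel> \<Delta>"

text \<open>
  A substitution \<open>\<sigma> :: var \<Rightarrow> 'a\<close> assigns an element to every variable, so that applying it
  always yields closed expressions. Any finite substitution that closes the expressions at hand
  extends to such a map without changing the result.
\<close>

definition tm_close :: "'a tm \<Rightarrow> (var \<Rightarrow> 'a) \<Rightarrow> 'a tm" where
  "tm_close t \<sigma> = tm_subst (\<lambda>v. Some (\<sigma> v)) t"

definition ctx_close :: "'a ctx \<Rightarrow> (var \<Rightarrow> 'a) \<Rightarrow> 'a ctx" where
  "ctx_close e \<sigma> = ctx_subst (\<lambda>v. Some (\<sigma> v)) e"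

definition cmd_close :: "'a cmd \<Rightarrow> (var \<Rightarrow> 'a) \<Rightarrow> 'a cmd" where
  "cmd_close c \<sigma> = cmd_subst (\<lambda>v. Some (\<sigma> v)) c"

definition fm_close :: "'a fm \<Rightarrow> (var \<Rightarrow> 'a) \<Rightarrow> 'a fm" where
  "fm_close A \<sigma> = fm_subst (\<lambda>X. FPar (\<sigma> (FmVar X))) A"

definition realizes_left :: "(var \<Rightarrow> 'a::conjunctive_structure) \<Rightarrow> 'a tyctx \<Rightarrow> bool" where
  "realizes_left \<sigma> \<Gamma> \<longleftrightarrow>
     (\<forall>x A. fmlookup \<Gamma> x = Some A \<longrightarrow> \<sigma> (TmVar x) \<le> fm_int (fm_close A \<sigma>))"

definition realizes_right :: "(var \<Rightarrow> 'a::conjunctive_structure) \<Rightarrow> 'a tyctx \<Rightarrow> bool" where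
  "realizes_right \<sigma> \<Delta> \<longleftrightarrow>
     (\<forall>\<alpha> A. fmlookup \<Delta> \<alpha> = Some A \<longrightarrow> \<sigma> (CtxVar \<alpha>) \<ge> fm_int (fm_close A \<sigma>))"

end

(* Adequacy is proved by induction on the typing derivation. Closing a formula and then interpreting
   it is the same as evaluating it in an environment, which turns the two quantifier rules into
   statements about updating the environment. In each rule for a mu-binder, the value of the type
   belongs to the set whose bound defines the interpretation, by the induction hypothesis for the
   substitution extended with that value. *)
theory Submission
  imports Defs
begin

text \<open>\<open>fm_int\<close> is arbitrary at free variables and recurses through substituted
  formulas. An environment gives free variables a value and makes the quantifier clause structural:
  \<open>case_nat a \<rho>\<close> puts \<open>a\<close> at index 0 and shifts the other values
  up.\<close>

primrec fm_eval :: "(nat \<Rightarrow> 'a::conjunctive_structure) \<Rightarrow> 'a fm \<Rightarrow> 'a" where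
  "fm_eval \<rho> (FPar a) = a"
| "fm_eval \<rho> (FVar X) = \<rho> X"
| "fm_eval \<rho> (FTensor A B) = fm_eval \<rho> A \<otimes> fm_eval \<rho> B"
| "fm_eval \<rho> (FNeg A) = neg (fm_eval \<rho> A)"
| "fm_eval \<rho> (FEx A) = (SUP a. fm_eval (case_nat a \<rho>) A)"

lemma fm_eval_cong: "(\<And>X. X \<in> fm_fv A \<Longrightarrow> \<rho> X = \<rho>' X) \<Longrightarrow> fm_eval \<rho> A = fm_eval \<rho>' A"
proof (induction A arbitrary: \<rho> \<rho>')
  case (FTensor A B)
  then show ?case by (metis UnCI fm_eval.simps(3) fm_fv.simps(3))
next
  case (FNeg A)
  then show ?case by (metis fm_eval.simps(4) fm_fv.simps(4))
next
  case (FEx A)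
  have "fm_eval (case_nat a \<rho>) A = fm_eval (case_nat a \<rho>') A" for a
    by (rule FEx.IH) (use FEx.prems in \<open>auto split: nat.split\<close>)
  then show ?case by simp
qed auto

lemma fm_eval_rename: "fm_eval \<rho> (fm_rename f A) = fm_eval (\<lambda>X. \<rho> (f X)) A"
proof (induction A arbitrary: \<rho> f)
  case (FEx A)
  have "(\<lambda>X. case_nat a \<rho> (case_nat 0 (\<lambda>X. Suc (f X)) X)) = case_nat a (\<lambda>X. \<rho> (f X))" for a
    by (rule ext) (simp split: nat.split)
  then show ?case using FEx by simp
qed auto

lemma fm_eval_subst: "fm_eval \<rho> (fm_subst \<theta> A) = fm_eval (\<lambda>X. fm_eval \<rho> (\<theta> X)) A"
proof (induction A arbitrary: \<rho> \<theta>)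
  case (FEx A)
  \<comment> \<open>Lifting by \<open>Suc\<close> skips index 0, so the formulas substituted for
    outer variables do not see the new value \<open>a\<close>.\<close>
  have "(\<lambda>X. fm_eval (case_nat a \<rho>) (case_nat (FVar 0) (\<lambda>X. fm_rename Suc (\<theta> X)) X))
      = case_nat a (\<lambda>X. fm_eval \<rho> (\<theta> X))" for a
    by (rule ext) (simp add: fm_eval_rename split: nat.split)
  then show ?case using FEx by simp
qed auto

lemma fm_eval_inst: "fm_eval \<rho> (fm_inst X B A) = fm_eval (\<rho>(X := fm_eval \<rho> B)) A"
proof -
  have "(\<lambda>Y. fm_eval \<rho> ((FVar(X := B)) Y)) = \<rho>(X := fm_eval \<rho> B)"
    by (rule ext) simp
  then show ?thesis by (simp add: fm_inst_def fm_eval_subst)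
qed

lemma fm_eval_Exists: "fm_eval \<rho> (Exists X A) = (SUP a. fm_eval (\<rho>(X := a)) A)"
proof -
  have "(\<lambda>Y. case_nat a \<rho> (if Y = X then 0 else Suc Y)) = \<rho>(X := a)" for a
    by (rule ext) simp
  then show ?thesis by (simp add: Exists_def fm_eval_rename)
qed

text \<open>
  Restricting \<open>\<eta>\<close> to parameters and variables avoids the commutation of substitution with
  lifting under a quantifier.
\<close>

lemma fm_subst_subst_par:
  "fm_subst \<theta> (fm_subst \<eta> A) = fm_subst (\<lambda>X. fm_subst \<theta> (\<eta> X)) A"
  if "\<And>X. (\<exists>a. \<eta> X = FPar a) \<or> (\<exists>Y. \<eta> X = FVar Y)"
  using that
proof (induction A arbitrary: \<theta> \<eta>)
  case (FEx A)
  define up where "up = (\<lambda>\<xi> :: nat \<Rightarrow> 'a fm. case_nat (FVar 0) (\<lambda>X. fm_rename Suc (\<xi> X)))"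
  have up: "(\<exists>a. up \<eta> X = FPar a) \<or> (\<exists>Y. up \<eta> X = FVar Y)" for X
    \<comment> \<open>At a successor index, \<open>up \<eta>\<close> lifts the value of
      \<open>\<eta>\<close> at the predecessor, hence \<open>X - 1\<close>. At index 0 the value is
      \<open>FVar 0\<close> in any case.\<close>
    using FEx.prems[of "X - 1"] by (cases X) (auto simp: up_def)
  have "fm_subst (up \<theta>) (up \<eta> X) = up (\<lambda>X. fm_subst \<theta> (\<eta> X)) X" for X
    using FEx.prems[of "X - 1"] by (cases X) (auto simp: up_def)
  then show ?case
    using FEx.IH[OF up, of "up \<theta>"] by (simp add: up_def)
qed auto

text \<open>Every variable becomes a parameter, so the arbitrary clause of \<open>fm_int\<close> is
  never reached. Under a quantifier, closing the outer variables and then filling index 0 with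
  \<open>a\<close> amounts to one closing by \<open>case_nat a \<rho>\<close>, so the two recursions
  agree.\<close>

lemma fm_int_subst_par: "fm_int (fm_subst (\<lambda>X. FPar (\<rho> X)) A) = fm_eval \<rho> A"
proof (induction A arbitrary: \<rho>)
  case (FEx A)
  have "fm_subst (case_nat (FPar a) FVar) (fm_subst (case_nat (FVar 0) (\<lambda>X. FPar (\<rho> X))) A)
      = fm_subst (\<lambda>X. FPar (case_nat a \<rho> X)) A" for a
  proof -
    have "(\<lambda>X. fm_subst (case_nat (FPar a) FVar) (case_nat (FVar 0) (\<lambda>X. FPar (\<rho> X)) X))
        = (\<lambda>X. FPar (case_nat a \<rho> X))"
      by (rule ext) (simp split: nat.split)
    then show ?thesis
      by (subst fm_subst_subst_par) (auto split: nat.split)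
  qed
  then show ?case using FEx by simp
qed auto

lemma fm_int_close: "fm_int (fm_close A \<sigma>) = fm_eval (\<lambda>X. \<sigma> (FmVar X)) A"
  by (simp add: fm_close_def fm_int_subst_par)

text \<open>Serves the binder cases of composition, where both substitutions are blocked at the
  bound name.\<close>

lemma map_add_None_upd: "s(v := None) ++ s'(v := None) = (s ++ s')(v := None)"
  by (rule ext) (simp add: map_add_def split: option.split)

text \<open>\<open>++\<close> gives priority to \<open>s'\<close>, which acts first: it inserts
  parameters, and \<open>s\<close> leaves these fixed.\<close>

lemma subst_subst:
  fixes t :: "'a tm" and e :: "'a ctx" and c :: "'a cmd"
  shows "tm_subst s (tm_subst s' t) = tm_subst (s ++ s') t"
    and "ctx_subst s (ctx_subst s' e) = ctx_subst (s ++ s') e"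
    and "cmd_subst s (cmd_subst s' c) = cmd_subst (s ++ s') c"
  by (induction t and e and c arbitrary: s s' and s s' and s s')
    (simp_all add: map_add_None_upd, simp_all add: map_add_def split: option.split)

text \<open>Expressions contain no formula variables. The left rule for the existential quantifier
  relies on this to vary the value of its eigenvariable.\<close>

lemma subst_cong:
  fixes t :: "'a tm" and e :: "'a ctx" and c :: "'a cmd"
  shows "(\<And>v. v \<notin> range FmVar \<Longrightarrow> s v = s' v) \<Longrightarrow> tm_subst s t = tm_subst s' t"
    and "(\<And>v. v \<notin> range FmVar \<Longrightarrow> s v = s' v) \<Longrightarrow> ctx_subst s e = ctx_subst s' e"
    and "(\<And>v. v \<notin> range FmVar \<Longrightarrow> s v = s' v) \<Longrightarrow> cmd_subst s c = cmd_subst s' c"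
proof (induction t and e and c arbitrary: s s' and s s' and s s')
  case (TMu \<alpha> c)
  show ?case by (simp, rule TMu.IH) (simp add: TMu.prems)
next
  case (CMuPair x y c)
  show ?case by (simp, rule CMuPair.IH) (simp add: CMuPair.prems)
next
  case (CMuBox \<alpha> c)
  show ?case by (simp, rule CMuBox.IH) (simp add: CMuBox.prems)
next
  case (CMu x c)
  show ?case by (simp, rule CMu.IH) (simp add: CMu.prems)
next
  case (TPair t u)
  then show ?case by (metis tm_subst.simps(3))
next
  case (TBox e)
  then show ?case by (metis tm_subst.simps(4))
next
  case (Cut t e)
  then show ?case by (metis cmd_subst.simps)
qed (auto simp: image_iff)

lemma ctx_close_upd_FmVar: "ctx_close e (\<sigma>(FmVar X := a)) = ctx_close e \<sigma>"
  unfolding ctx_close_def by (rule subst_cong) auto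

text \<open>Closing a binder leaves the bound variable open in its body, and the interpretation
  fills it afterwards. The two stages merge into one total substitution, to which an induction
  hypothesis applies.\<close>

lemma cmd_subst_close1:
  "cmd_subst [v \<mapsto> a] (cmd_subst ((\<lambda>v. Some (\<sigma> v))(v := None)) c) = cmd_close c (\<sigma>(v := a))"
proof -
  have "[v \<mapsto> a] ++ (\<lambda>v. Some (\<sigma> v))(v := None) = (\<lambda>w. Some ((\<sigma>(v := a)) w))"
    by (rule ext) (simp add: map_add_def)
  then show ?thesis by (simp add: subst_subst cmd_close_def)
qed

lemma cmd_subst_close2:
  "cmd_subst [v \<mapsto> a, w \<mapsto> b] (cmd_subst ((\<lambda>v. Some (\<sigma> v))(v := None, w := None)) c)
    = cmd_close c (\<sigma>(v := a, w := b))"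
proof -
  have "[v \<mapsto> a, w \<mapsto> b] ++ (\<lambda>v. Some (\<sigma> v))(v := None, w := None)
      = (\<lambda>u. Some ((\<sigma>(v := a, w := b)) u))"
    by (rule ext) (simp add: map_add_def)
  then show ?thesis by (simp add: subst_subst cmd_close_def)
qed

text \<open>These equations make the interpretation compositional in \<open>\<sigma>\<close>, so
  that each typing rule can be checked without computing substitutions.\<close>

lemma int_close:
  "tm_int (tm_close (TVar x) \<sigma>) = \<sigma> (TmVar x)"
  "tm_int (tm_close (TPair t u) \<sigma>) = tm_int (tm_close t \<sigma>) \<otimes> tm_int (tm_close u \<sigma>)"
  "tm_int (tm_close (TBox e) \<sigma>) = neg (ctx_int (ctx_close e \<sigma>))"
  "tm_int (tm_close (TMu \<alpha> c) \<sigma>) = Inf {a. cmd_int (cmd_close c (\<sigma>(CtxVar \<alpha> := a))) \<in> pole}"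
  "ctx_int (ctx_close (CVar \<alpha>) \<sigma>) = \<sigma> (CtxVar \<alpha>)"
  "ctx_int (ctx_close (CMuPair x y c) \<sigma>) =
     Sup {a \<otimes> b |a b. cmd_int (cmd_close c (\<sigma>(TmVar x := a, TmVar y := b))) \<in> pole}"
  "ctx_int (ctx_close (CMuBox \<alpha> c) \<sigma>) =
     Sup {neg a |a. cmd_int (cmd_close c (\<sigma>(CtxVar \<alpha> := a))) \<in> pole}"
  "ctx_int (ctx_close (CMu x c) \<sigma>) = Sup {a. cmd_int (cmd_close c (\<sigma>(TmVar x := a))) \<in> pole}"
  "cmd_int (cmd_close (Cut t e) \<sigma>) = (tm_int (tm_close t \<sigma>), ctx_int (ctx_close e \<sigma>))"
  \<comment> \<open>\<open>cmd_close_def\<close> is unfolded at the cut only: the bodies of binders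
    stay folded, as the merging lemmas produce them.\<close>
  unfolding tm_close_def ctx_close_def cmd_close_def[of "Cut t e"]
  by (simp_all add: cmd_subst_close1 cmd_subst_close2)

text \<open>Types depend on formula variables only, so they keep their values when \<open>x\<close>
  is reassigned; a former type of \<open>x\<close> is hidden by \<open>fmupd\<close>.\<close>

lemma realizes_left_upd:
  assumes "realizes_left \<sigma> \<Gamma>" "a \<le> fm_int (fm_close A \<sigma>)"
  shows "realizes_left (\<sigma>(TmVar x := a)) (fmupd x A \<Gamma>)"
  using assms by (auto simp: realizes_left_def fm_int_close)

lemma realizes_right_upd:
  assumes "realizes_right \<sigma> \<Delta>" "fm_int (fm_close A \<sigma>) \<le> a"
  shows "realizes_right (\<sigma>(CtxVar \<alpha> := a)) (fmupd \<alpha> A \<Delta>)"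
  using assms by (auto simp: realizes_right_def fm_int_close)

lemma realizes_left_upd_CtxVar: "realizes_left (\<sigma>(CtxVar \<alpha> := a)) \<Gamma> = realizes_left \<sigma> \<Gamma>"
  by (simp add: realizes_left_def fm_int_close)

lemma realizes_right_upd_TmVar: "realizes_right (\<sigma>(TmVar x := a)) \<Delta> = realizes_right \<sigma> \<Delta>"
  by (simp add: realizes_right_def fm_int_close)

lemma fm_int_close_upd_FmVar:
  "X \<notin> fm_fv A \<Longrightarrow> fm_int (fm_close A (\<sigma>(FmVar X := a))) = fm_int (fm_close A \<sigma>)"
  unfolding fm_int_close by (rule fm_eval_cong) auto

lemma realizes_left_upd_FmVar:
  assumes "realizes_left \<sigma> \<Gamma>" "\<forall>B \<in> fmran' \<Gamma>. X \<notin> fm_fv B"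
  shows "realizes_left (\<sigma>(FmVar X := a)) \<Gamma>"
  using assms by (auto simp: realizes_left_def fm_int_close_upd_FmVar fmran'I)

lemma realizes_right_upd_FmVar:
  assumes "realizes_right \<sigma> \<Delta>" "\<forall>B \<in> fmran' \<Delta>. X \<notin> fm_fv B"
  shows "realizes_right (\<sigma>(FmVar X := a)) \<Delta>"
  using assms by (auto simp: realizes_right_def fm_int_close_upd_FmVar fmran'I)

theorem adequacy:
  fixes \<Gamma> \<Delta> :: "'a::conjunctive_structure tyctx"
  shows "\<Gamma> \<turnstile> t : A \<parallel> \<Delta> \<Longrightarrow> realizes_left \<sigma> \<Gamma> \<Longrightarrow> realizes_right \<sigma> \<Delta> \<Longrightarrow>
      tm_int (tm_close t \<sigma>) \<le> fm_int (fm_close A \<sigma>)"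
    and "\<Gamma> \<parallel> e : A \<turnstile> \<Delta> \<Longrightarrow> realizes_left \<sigma> \<Gamma> \<Longrightarrow> realizes_right \<sigma> \<Delta> \<Longrightarrow>
      fm_int (fm_close A \<sigma>) \<le> ctx_int (ctx_close e \<sigma>)"
    and "c : (\<Gamma> \<turnstile> \<Delta>) \<Longrightarrow> realizes_left \<sigma> \<Gamma> \<Longrightarrow> realizes_right \<sigma> \<Delta> \<Longrightarrow>
      cmd_int (cmd_close c \<sigma>) \<in> pole"
proof (induction arbitrary: \<sigma> and \<sigma> and \<sigma> rule: tm_typed_ctx_typed_cmd_typed.inducts)
  case (cut \<Gamma> t A \<Delta> e)
  then show ?case by (auto simp: int_close pole_def intro: order_trans)
next
  case (ax_left \<Delta> \<alpha> A \<Gamma>)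
  then show ?case by (simp add: int_close realizes_right_def)
next
  case (ax_right \<Gamma> x A \<Delta>)
  then show ?case by (simp add: int_close realizes_left_def)
next
  case (mu_left c x A \<Gamma> \<Delta>)
  have "cmd_int (cmd_close c (\<sigma>(TmVar x := fm_int (fm_close A \<sigma>)))) \<in> pole"
    by (rule mu_left.IH)
      (use mu_left.prems in \<open>simp_all only: realizes_left_upd realizes_right_upd_TmVar order_refl\<close>)
  then show ?case by (auto simp: int_close intro!: Sup_upper)
next
  case (tensor_left x x' c B A \<Gamma> \<Delta>)
  let ?a = "fm_int (fm_close A \<sigma>)" and ?b = "fm_int (fm_close B \<sigma>)"
  have "cmd_int (cmd_close c (\<sigma>(TmVar x := ?a, TmVar x' := ?b))) \<in> pole"
  proof (rule tensor_left.IH)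
    show "realizes_left (\<sigma>(TmVar x := ?a, TmVar x' := ?b)) (fmupd x' B (fmupd x A \<Gamma>))"
      \<comment> \<open>The bound on \<open>?b\<close> is required under the substitution already
        updated at \<open>x\<close>; by \<open>fm_int_close\<close> that update does not affect
        \<open>B\<close>.\<close>
      using tensor_left.prems by (intro realizes_left_upd) (simp_all add: fm_int_close)
  qed (use tensor_left.prems in \<open>simp only: realizes_right_upd_TmVar\<close>)
  moreover have "fm_int (fm_close (FTensor A B) \<sigma>) = ?a \<otimes> ?b"
    by (simp add: fm_int_close)
  ultimately show ?case by (auto simp: int_close intro!: Sup_upper)
next
  case (neg_left c \<Gamma> \<alpha> A \<Delta>)
  have "cmd_int (cmd_close c (\<sigma>(CtxVar \<alpha> := fm_int (fm_close A \<sigma>)))) \<in> pole"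
    by (rule neg_left.IH)
      (use neg_left.prems in \<open>simp_all only: realizes_left_upd_CtxVar realizes_right_upd order_refl\<close>)
  moreover have "fm_int (fm_close (FNeg A) \<sigma>) = neg (fm_int (fm_close A \<sigma>))"
    by (simp add: fm_int_close)
  ultimately show ?case by (auto simp: int_close intro!: Sup_upper)
next
  case (mu_right c \<Gamma> \<alpha> A \<Delta>)
  have "cmd_int (cmd_close c (\<sigma>(CtxVar \<alpha> := fm_int (fm_close A \<sigma>)))) \<in> pole"
    by (rule mu_right.IH)
      (use mu_right.prems in \<open>simp_all only: realizes_left_upd_CtxVar realizes_right_upd order_refl\<close>)
  then show ?case by (auto simp: int_close intro!: Inf_lower)
next
  case (tensor_right \<Gamma> t A \<Delta> u B)
  then show ?case by (simp add: int_close fm_int_close tensor_mono)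
next
  case (neg_right \<Gamma> e A \<Delta>)
  then show ?case by (simp add: int_close fm_int_close neg_antimono)
next
  case (exists_left \<Gamma> e A \<Delta> X)
  \<comment> \<open>The induction hypothesis is used once for each value \<open>a\<close> of the
    eigenvariable. The side condition keeps both typing contexts realized, and \<open>e\<close> does
    not see \<open>X\<close>, so one bound serves the whole join.\<close>
  have "fm_eval ((\<lambda>Y. \<sigma> (FmVar Y))(X := a)) A \<le> ctx_int (ctx_close e \<sigma>)" for a
  proof -
    have "fm_int (fm_close A (\<sigma>(FmVar X := a))) \<le> ctx_int (ctx_close e (\<sigma>(FmVar X := a)))"
      by (rule exists_left.IH)
        (use exists_left.hyps exists_left.prems in
          \<open>blast intro: realizes_left_upd_FmVar realizes_right_upd_FmVar\<close>)+
    moreover have "(\<lambda>Y. (\<sigma>(FmVar X := a)) (FmVar Y)) = (\<lambda>Y. \<sigma> (FmVar Y))(X := a)"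
      by (rule ext) simp
    ultimately show ?thesis by (simp only: fm_int_close ctx_close_upd_FmVar)
  qed
  then show ?case by (simp add: fm_int_close fm_eval_Exists SUP_le_iff)
next
  case (exists_right V \<Gamma> X B A \<Delta>)
  \<comment> \<open>The join is bounded below by its member at the value of \<open>B\<close> under
    \<open>\<sigma>\<close>, which by \<open>fm_eval_inst\<close> is the value of the
    instance.\<close>
  then show ?case
    by (auto simp: fm_int_close fm_eval_Exists fm_eval_inst intro: SUP_upper2)
qed

theorem mainTheorem13:
  fixes \<Gamma> \<Delta> :: "'a::conjunctive_structure tyctx"
    and A :: "'a fm"
    and \<sigma> :: "var \<Rightarrow> 'a"
  assumes "realizes_left \<sigma> \<Gamma>"
    and "realizes_right \<sigma> \<Delta>"
  shows "(\<forall>t. (\<Gamma> \<turnstile> t : A \<parallel> \<Delta>) \<longrightarrow> tm_int (tm_close t \<sigma>) \<le> fm_int (fm_close A \<sigma>)) \<and>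
         (\<forall>e. (\<Gamma> \<parallel> e : A \<turnstile> \<Delta>) \<longrightarrow> ctx_int (ctx_close e \<sigma>) \<ge> fm_int (fm_close A \<sigma>)) \<and>
         (\<forall>c. (c : (\<Gamma> \<turnstile> \<Delta>)) \<longrightarrow> cmd_int (cmd_close c \<sigma>) \<in> pole)"
  using adequacy assms by blast

end
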